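(* Let $\lambda_0\ge 1$ be an integer and consider the family of restart strategies defined recursively by $\lambda_k=\lceil\lambda_{k-1}\rho\rceil$, $k\ge 1$, with restart parameter $\rho\in\mathbb{R}$, $\rho>1$. This strategy type is asymptotically optimal with optimal choice $\hat\rho=2$ of the restart parameter, with respect to the asymptotic upper bound $\overline{\ell}^{*}_{\mathrm{up}}(\rho)=\lim_{\hat\lambda\to\infty}\ell^*_{\mathrm{up}}(\hat\lambda,\rho)=\rho+\frac{1}{\rho-1}$ of the relative loss function. Furthermore, $\overline{\ell}^{*}_{\mathrm{up}}(\hat\rho)=3$.
   Context: For an integer $\hat\lambda\ge\lambda_0$ let $\hat k(\hat\lambda)=\min\{k\ge 0 : \lambda_k\ge\hat\lambda\}$. The loss function of the strategy $\lambda_k=\lceil\lambda_{k-1}\rho\rceil$ is $\mathcal{L}^*(\hat\lambda,\rho)=\sum_{k=0}^{\hat k(\hat\lambda)}\lambda_k-\hat\lambda$, and the relative loss function is $\ell^*(\hat\lambda,\rho)=\mathcal{L}^*(\hat\lambda,\rho)/\hat\lambda$. If $\ell_{\mathrm{up}}(\hat\lambda,\rho)$ is an upper bound of the relative loss function (for all integers $\hat\lambda\ge\lambda_0$), then $\overline{\ell}_{\mathrm{up}}(\rho)=\lim_{\hat\lambda\to\infty}\ell_{\mathrm{up}}(\hat\lambda,\rho)$ is called the asymptotic upper bound. Here the upper bound used is $$\ell^*_{\mathrm{up}}(\hat\lambda,\rho)=\frac{1}{\hat\lambda}\left(\lambda_0\rho+\frac{\ln(\hat\lambda/\lambda_0)}{\ln(\rho)}+(\hat\lambda-\lambda_0)\left(\rho+\frac{1}{\rho-1}\right)\right).$$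 A strategy is bounded if a finite asymptotic upper bound exists for the given restart parameter. A bounded strategy type is called asymptotically optimal if there exists a restart parameter for which the asymptotic upper bound is minimal (among all admissible restart parameters, here all $\rho>1$); this value, independent of $\hat\lambda$, is called the optimal choice of the restart parameter and is denoted $\hat\rho$. *)

theory Defs
  imports Complex_Main
begin

text \<open>A restart strategy is the sequence \<open>s 0, s 1, \<dots>\<close> of its integer values \<open>\<lambda>\<^sub>0, \<lambda>\<^sub>1, \<dots>\<close>.\<close>

definition khat :: "(nat \<Rightarrow> int) \<Rightarrow> int \<Rightarrow> nat" where
  "khat s n = (LEAST k. s k \<ge> n)"

definition loss :: "(nat \<Rightarrow> int) \<Rightarrow> int \<Rightarrow> int" where
  "loss s n = (\<Sum>k = 0..khat s n. s k) - n"

definition rel_loss :: "(nat \<Rightarrow> int) \<Rightarrow> int \<Rightarrow> real" where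
  "rel_loss s n = real_of_int (loss s n) / real_of_int n"

definition rel_loss_upper_bound :: "(nat \<Rightarrow> int) \<Rightarrow> (int \<Rightarrow> real) \<Rightarrow> bool" where
  "rel_loss_upper_bound s u \<longleftrightarrow> (\<forall>n \<ge> s 0. rel_loss s n \<le> u n)"

text \<open>\<open>L\<close> is the (finite) asymptotic upper bound belonging to the upper bound \<open>u\<close>. The limit is
  taken along the integers, and \<open>L\<close> is uniquely determined by \<open>u\<close>.\<close>

definition asymptotic_upper_bound :: "(nat \<Rightarrow> int) \<Rightarrow> (int \<Rightarrow> real) \<Rightarrow> real \<Rightarrow> bool" where
  "asymptotic_upper_bound s u L \<longleftrightarrow> rel_loss_upper_bound s u \<and> (u \<longlongrightarrow> L) at_top"

definition bounded_strategy :: "(nat \<Rightarrow> int) \<Rightarrow> bool" where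
  "bounded_strategy s \<longleftrightarrow> (\<exists>u L. asymptotic_upper_bound s u L)"

text \<open>A strategy type is a family \<open>S\<close> of strategies indexed by the restart parameter, which ranges
  over the set \<open>P\<close> of admissible values; \<open>U r\<close> is the upper bound used for the strategy \<open>S r\<close>.\<close>

definition optimal_choice ::
    "real set \<Rightarrow> (real \<Rightarrow> nat \<Rightarrow> int) \<Rightarrow> (real \<Rightarrow> int \<Rightarrow> real) \<Rightarrow> real \<Rightarrow> bool" where
  "optimal_choice P S U r\<^sub>0 \<longleftrightarrow> r\<^sub>0 \<in> P \<and>
     (\<exists>L\<^sub>0. asymptotic_upper_bound (S r\<^sub>0) (U r\<^sub>0) L\<^sub>0 \<and>
       (\<forall>r \<in> P. \<exists>L. asymptotic_upper_bound (S r) (U r) L \<and> L\<^sub>0 \<le> L))"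

definition asymptotically_optimal ::
    "real set \<Rightarrow> (real \<Rightarrow> nat \<Rightarrow> int) \<Rightarrow> (real \<Rightarrow> int \<Rightarrow> real) \<Rightarrow> bool" where
  "asymptotically_optimal P S U \<longleftrightarrow>
     (\<forall>r \<in> P. bounded_strategy (S r)) \<and> (\<exists>r\<^sub>0. optimal_choice P S U r\<^sub>0)"

primrec geometric_strategy :: "int \<Rightarrow> real \<Rightarrow> nat \<Rightarrow> int" where
  "geometric_strategy l\<^sub>0 r 0 = l\<^sub>0"
| "geometric_strategy l\<^sub>0 r (Suc k) = \<lceil>real_of_int (geometric_strategy l\<^sub>0 r k) * r\<rceil>"

definition geometric_loss_up :: "int \<Rightarrow> real \<Rightarrow> int \<Rightarrow> real" where
  "geometric_loss_up l\<^sub>0 r n =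
     (1 / real_of_int n) *
     (real_of_int l\<^sub>0 * r + ln (real_of_int n / real_of_int l\<^sub>0) / ln r
      + (real_of_int n - real_of_int l\<^sub>0) * (r + 1 / (r - 1)))"

end

theory Submission
  imports Defs "HOL-Real_Asymp.Real_Asymp"
begin

text \<open>The last value \<open>s (k - 1)\<close> below \<open>n\<close> is at most \<open>n - 1\<close>, so the ceiling in
  \<open>s k\<close> is absorbed by \<open>s k \<le> (n - 1) * r + 1\<close>, while \<open>(r - 1) * s i \<le> s (i + 1) - s i\<close>
  telescopes to bound the sum of the earlier values.  The limit then follows since \<open>ln n / n\<close>
  vanishes, and \<open>r + 1 / (r - 1) - 3 = (r - 2)\<^sup>2 / (r - 1)\<close> gives the unique minimiser.\<close>

text \<open>A positive integer times \<open>r > 1\<close> exceeds that integer, so the ceiling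
  climbs by at least one. This linear growth is enough to make the strategy reach every
  \<open>n\<close>.\<close>

lemma geometric_strategy_ge:
  assumes "l \<ge> 1" "r > 1"
  shows "geometric_strategy l r k \<ge> l + int k"
proof (induction k)
  case (Suc k)
  let ?x = "real_of_int (geometric_strategy l r k)"
  have "?x > 0" using Suc assms(1) by simp
  then have "?x < ?x * r" using assms(2) by simp
  then have "geometric_strategy l r k < geometric_strategy l r (Suc k)"
    by (simp add: less_ceiling_iff)
  with Suc show ?case by simp
qed simp

lemma geometric_strategy_sum_le:
  assumes "r > 1"
  shows "(\<Sum>i<k. real_of_int (geometric_strategy l r i))
    \<le> (real_of_int (geometric_strategy l r k) - real_of_int l) / (r - 1)"
proof (induction k)
  case (Suc k)
  let ?s = "\<lambda>i. real_of_int (geometric_strategy l r i)"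
  have "?s k * r \<le> ?s (Suc k)" by simp
  then have "?s k \<le> (?s (Suc k) - ?s k) / (r - 1)"
    using assms by (simp add: pos_le_divide_eq right_diff_distrib del: geometric_strategy.simps)
  then show ?case using Suc by (simp add: diff_divide_distrib del: geometric_strategy.simps)
qed simp

lemma geometric_strategy_loss_le:
  assumes l: "l \<ge> 1" and r: "r > 1" and n: "n > l"
  shows "real_of_int (loss (geometric_strategy l r) n)
    \<le> (real_of_int n - 1) * r + (real_of_int n - 1 - real_of_int l) / (r - 1)"
proof -
  define s where "s = geometric_strategy l r"
  \<comment> \<open>An explicit index reaching \<open>n\<close> is needed so that the
    \<open>LEAST\<close> in \<open>khat\<close> denotes an actual minimum.\<close>
  have "s (nat (n - l)) \<ge> n"
    using geometric_strategy_ge[OF l r, of "nat (n - l)"] n by (simp add: s_def)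
  then have "s (khat s n) \<ge> n" unfolding khat_def by (rule LeastI)
  \<comment> \<open>The start value \<open>l\<close> lies strictly below \<open>n\<close>, so the
    first index reaching \<open>n\<close> has a predecessor.\<close>
  then have "khat s n \<noteq> 0" using n by (auto simp: s_def intro: ccontr)
  then obtain k where k: "khat s n = Suc k" by (cases "khat s n") auto
  have "\<not> s k \<ge> n" using k not_less_Least[of k "\<lambda>k. s k \<ge> n"] by (simp add: khat_def)
  then have sk: "real_of_int (s k) \<le> real_of_int n - 1" by linarith
  have "real_of_int (s (Suc k)) \<le> real_of_int (s k) * r + 1"
    unfolding s_def geometric_strategy.simps by linarith
  also have "\<dots> \<le> (real_of_int n - 1) * r + 1"
    using sk r by simp
  finally have last: "real_of_int (s (Suc k)) \<le> (real_of_int n - 1) * r + 1" .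
  have "(\<Sum>i<k. real_of_int (s i)) \<le> (real_of_int (s k) - real_of_int l) / (r - 1)"
    unfolding s_def by (rule geometric_strategy_sum_le[OF r])
  also have "\<dots> \<le> (real_of_int n - 1 - real_of_int l) / (r - 1)"
    using sk r by (intro divide_right_mono) auto
  finally have sum: "(\<Sum>i<k. real_of_int (s i)) \<le> \<dots>" .
  \<comment> \<open>The last two summands are split off. Since \<open>s k \<le> n - 1\<close>, the
    sum of \<open>s k\<close> and the ceiling error \<open>1\<close> is cancelled by the subtracted
    \<open>n\<close>.\<close>
  have "real_of_int (loss s n)
      = (\<Sum>i<k. real_of_int (s i)) + real_of_int (s k) + real_of_int (s (Suc k)) - real_of_int n"
    by (simp add: loss_def k atLeast0AtMost lessThan_Suc_atMost[symmetric])
  then show ?thesis using last sum sk unfolding s_def by linarith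
qed

lemma geometric_loss_up_upper_bound:
  assumes l: "l \<ge> 1" and r: "r > 1"
  shows "rel_loss_upper_bound (geometric_strategy l r) (geometric_loss_up l r)"
  unfolding rel_loss_upper_bound_def
proof (intro allI impI)
  fix n assume "n \<ge> geometric_strategy l r 0"
  then have n: "n \<ge> l" by simp
  let ?n = "real_of_int n" and ?l = "real_of_int l"
  have ln: "ln (?n / ?l) / ln r \<ge> 0" using l r n by simp
  have "real_of_int (loss (geometric_strategy l r) n)
      \<le> ?l * r + ln (?n / ?l) / ln r + (?n - ?l) * (r + 1 / (r - 1))"
  proof (cases "n = l")
    case True
    \<comment> \<open>At \<open>n = l\<close> the start value already succeeds: the loss is
      \<open>l - l = 0\<close>, and the bound reduces to \<open>l * r\<close>.\<close>
    have "khat (geometric_strategy l r) l = 0" unfolding khat_def by (rule Least_eq_0) simp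
    then show ?thesis using True l r by (simp add: loss_def)
  next
    case False
    have "(?n - 1) * r + (?n - 1 - ?l) / (r - 1) \<le> ?n * r + (?n - ?l) / (r - 1)"
      using r by (intro add_mono divide_right_mono) auto
    \<comment> \<open>Writing \<open>?n * r\<close> as \<open>?l * r + (?n - ?l) * r\<close> gives
      the required form up to the nonnegative logarithmic term.\<close>
    also have "\<dots> = ?l * r + (?n - ?l) * (r + 1 / (r - 1))"
      by (simp add: algebra_simps)
    finally show ?thesis
      using geometric_strategy_loss_le[OF l r, of n] n False ln by linarith
  qed
  then show "rel_loss (geometric_strategy l r) n \<le> geometric_loss_up l r n"
    using l n by (simp add: rel_loss_def geometric_loss_up_def divide_right_mono)
qed

lemma geometric_loss_up_tendsto:
  assumes "l \<ge> 1" "r > 1"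
  shows "(geometric_loss_up l r \<longlongrightarrow> r + 1 / (r - 1)) at_top"
proof -
  \<comment> \<open>The limit is taken over the reals with abstract constants, of which only signs
    matter, and then restricted to the integers by composition.\<close>
  have "((\<lambda>x::real. 1 / x * (a + ln (x / b) / c + (x - b) * d)) \<longlongrightarrow> d) at_top"
    if "b > 0" "c > 0" "d > 0" for a b c d :: real
    using that by real_asymp
  from this[of "real_of_int l" "ln r" "r + 1 / (r - 1)"]
  show ?thesis unfolding geometric_loss_up_def[abs_def] using assms
    by (intro filterlim_compose[OF _ filterlim_real_of_int_at_top]) (auto simp: add_pos_pos)
qed

lemma geometric_asymptotic_upper_bound:
  assumes "l \<ge> 1" "r > 1"
  shows "asymptotic_upper_bound (geometric_strategy l r) (geometric_loss_up l r) (r + 1 / (r - 1))"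
  using assms geometric_loss_up_upper_bound geometric_loss_up_tendsto
  by (simp add: asymptotic_upper_bound_def)

text \<open>Optimality quantifies existentially over the limits; uniqueness identifies them with the
  explicit values.\<close>

lemma asymptotic_upper_bound_unique:
  assumes "asymptotic_upper_bound s u L" "asymptotic_upper_bound s u L'"
  shows "L = L'"
  using assms tendsto_unique[of "at_top :: int filter"] by (auto simp: asymptotic_upper_bound_def)

lemma asymptotic_value_ge_3:
  fixes r :: real
  assumes "r > 1"
  shows "3 \<le> r + 1 / (r - 1)" and "r + 1 / (r - 1) \<le> 3 \<Longrightarrow> r = 2"
proof -
  have *: "r + 1 / (r - 1) = 3 + (r - 2)\<^sup>2 / (r - 1)"
    using assms by (simp add: field_simps power2_eq_square)
  show "3 \<le> r + 1 / (r - 1)" using assms by (simp add: *)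
  show "r = 2" if "r + 1 / (r - 1) \<le> 3"
    using that assms by (simp add: * divide_le_0_iff)
qed

lemma geometric_optimal_choice_iff:
  assumes l: "l \<ge> 1"
  shows "optimal_choice {1<..} (geometric_strategy l) (geometric_loss_up l) r \<longleftrightarrow> r = 2"
proof
  note bound = geometric_asymptotic_upper_bound[OF l]
  assume "optimal_choice {1<..} (geometric_strategy l) (geometric_loss_up l) r"
  \<comment> \<open>Comparison with the single competitor \<open>2\<close>, whose value is
    \<open>3\<close>, already forces \<open>r + 1 / (r - 1) \<le> 3\<close>.\<close>
  then obtain L\<^sub>0 L where r: "r > 1"
    and L0: "asymptotic_upper_bound (geometric_strategy l r) (geometric_loss_up l r) L\<^sub>0"
    and L: "asymptotic_upper_bound (geometric_strategy l 2) (geometric_loss_up l 2) L" "L\<^sub>0 \<le> L"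
    unfolding optimal_choice_def by fastforce
  have "L\<^sub>0 = r + 1 / (r - 1)" "L = 3"
    using asymptotic_upper_bound_unique[OF L0 bound[OF r]]
      asymptotic_upper_bound_unique[OF L(1) bound] by simp_all
  then show "r = 2" using L(2) asymptotic_value_ge_3(2)[OF r] by simp
next
  assume "r = 2"
  then show "optimal_choice {1<..} (geometric_strategy l) (geometric_loss_up l) r"
    using geometric_asymptotic_upper_bound[OF l] geometric_asymptotic_upper_bound[OF l, of 2]
      asymptotic_value_ge_3(1)
    unfolding optimal_choice_def by fastforce
qed

theorem theorem11:
  fixes l\<^sub>0 :: int
  assumes "l\<^sub>0 \<ge> 1"
  shows "asymptotically_optimal {1<..} (geometric_strategy l\<^sub>0) (geometric_loss_up l\<^sub>0) \<and>
    (\<forall>r. optimal_choice {1<..} (geometric_strategy l\<^sub>0) (geometric_loss_up l\<^sub>0) r \<longleftrightarrow> r = 2) \<and>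
    (\<forall>r > 1. asymptotic_upper_bound (geometric_strategy l\<^sub>0 r) (geometric_loss_up l\<^sub>0 r)
                (r + 1 / (r - 1))) \<and>
    asymptotic_upper_bound (geometric_strategy l\<^sub>0 2) (geometric_loss_up l\<^sub>0 2) 3"
  using geometric_asymptotic_upper_bound[OF assms] geometric_asymptotic_upper_bound[OF assms, of 2]
    geometric_optimal_choice_iff[OF assms]
  by (auto simp: asymptotically_optimal_def bounded_strategy_def)

end
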